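(* Let $Y$ be a locally compact Tychonoff space, and let $X$ be a Tychonoff $k_{\mathbb{R}}$-space. Then $X\times Y$ is a $k_{\mathbb{R}}$-space.
   Context: All spaces are assumed to be Tychonoff. A function $f:X\to\mathbb{R}$ is $k$-continuous if its restriction to every compact subset of $X$ is continuous. A space $X$ is a $k_{\mathbb{R}}$-space if every $k$-continuous function $f:X\to\mathbb{R}$ is continuous. *)

theory Defs
  imports "HOL-Analysis.Analysis"
begin

definition Tychonoff_space :: "'a topology \<Rightarrow> bool" where
  "Tychonoff_space X \<longleftrightarrow> completely_regular_space X \<and> Hausdorff_space X"

text \<open>Functions are total on the type; only their values on \<^term>\<open>topspace X\<close> matter.
  Note that \<^term>\<open>compactin X K\<close> includes \<^term>\<open>K \<subseteq> topspace X\<close>.\<close>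

definition k_continuous :: "'a topology \<Rightarrow> ('a \<Rightarrow> real) \<Rightarrow> bool" where
  "k_continuous X f \<longleftrightarrow>
     (\<forall>K. compactin X K \<longrightarrow> continuous_map (subtopology X K) euclideanreal f)"

definition kR_space :: "'a topology \<Rightarrow> bool" where
  "kR_space X \<longleftrightarrow>
     (\<forall>f. k_continuous X f \<longrightarrow> continuous_map X euclideanreal f)"

end

theory Submission
  imports Defs
begin

text \<open>Given \<open>(a, b)\<close> and a compact neighbourhood \<open>L\<close> of \<open>b\<close>, the function
  \<open>g x = (SUP y\<in>L. \<bar>f (x, y) - f (a, y)\<bar>)\<close> is \<open>k\<close>-continuous on \<open>X\<close>, hence continuous, and it
  vanishes at \<open>a\<close>. So near \<open>a\<close> the value \<open>f (x, y)\<close> is close to \<open>f (a, y)\<close> uniformly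
  in \<open>y \<in> L\<close>, and \<open>f (a, y)\<close> is close to \<open>f (a, b)\<close> for \<open>y\<close> near \<open>b\<close>.\<close>

lemma continuous_map_euclideanreal_iff:
  "continuous_map X euclideanreal g \<longleftrightarrow>
     (\<forall>x \<in> topspace X. \<forall>e>0. \<exists>U. openin X U \<and> x \<in> U \<and> (\<forall>y\<in>U. \<bar>g y - g x\<bar> < e))"
  using Met_TC.continuous_map_to_metric[of X g]
  by (simp add: dist_real_def abs_minus_commute)

text \<open>Compactness of \<open>Y\<close> makes closeness to the slice at \<open>a\<close>
  uniform: by the tube lemma, one neighbourhood of \<open>a\<close> serves all \<open>y\<close> at
  once. Functions of \<open>y\<close> that are uniformly close have close suprema.\<close>

lemma continuous_map_SUP_compact_space:
  fixes f :: "'a \<times> 'b \<Rightarrow> real"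
  assumes Y: "compact_space Y" and ne: "topspace Y \<noteq> {}"
    and f: "continuous_map (prod_topology X Y) euclideanreal f"
  shows "continuous_map X euclideanreal (\<lambda>x. SUP y\<in>topspace Y. f (x, y))"
  unfolding continuous_map_euclideanreal_iff
proof (intro ballI allI impI)
  fix a and e :: real
  assume a: "a \<in> topspace X" and e: "e > 0"
  have slice: "continuous_map Y euclideanreal (\<lambda>y. f (x, y))" if "x \<in> topspace X" for x
    using continuous_map_compose[OF _ f, of Y "\<lambda>y. (x, y)"] that
    by (simp add: continuous_map_pairedI o_def)
  \<comment> \<open>On the reals, \<open>SUP\<close> dominates its members only for sets bounded
    above; here the set is a compact image.\<close>
  have bdd: "bdd_above ((\<lambda>y. f (x, y)) ` topspace Y)" if "x \<in> topspace X" for x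
  proof -
    have "compactin euclideanreal ((\<lambda>y. f (x, y)) ` topspace Y)"
      using Y slice[OF that] image_compactin unfolding compact_space_def by blast
    then show ?thesis
      by (simp add: bounded_imp_bdd_above compact_imp_bounded)
  qed
  \<comment> \<open>\<open>W\<close> contains the slice over \<open>a\<close>, where the difference
    is 0. The margin is \<open>e/2\<close> because passing to suprema preserves only non-strict
    bounds, while the final bound has to be strictly below \<open>e\<close>.\<close>
  define W where "W = {p \<in> topspace (prod_topology X Y). f p - f (a, snd p) \<in> {-e/2<..<e/2}}"
  have "continuous_map (prod_topology X Y) euclideanreal (\<lambda>p. f p - f (a, snd p))"
    using continuous_map_compose[OF continuous_map_snd slice[OF a], of X]
    by (intro continuous_map_diff f) (simp add: o_def)
  then have "openin (prod_topology X Y) W"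
    unfolding W_def by (rule openin_continuous_map_preimage) simp
  moreover have "{a} \<times> topspace Y \<subseteq> W"
    using a e by (auto simp: W_def)
  ultimately obtain U V where U: "openin X U" "a \<in> U" "topspace Y \<subseteq> V" "U \<times> V \<subseteq> W"
    using tube_lemma_right[of X Y W "topspace Y" a] Y a unfolding compact_space_def by blast
  have "\<bar>(SUP y\<in>topspace Y. f (x, y)) - (SUP y\<in>topspace Y. f (a, y))\<bar> < e" if "x \<in> U" for x
  proof -
    have x: "x \<in> topspace X"
      using U(1) that openin_subset by blast
    have near: "f (x, y) \<le> f (a, y) + e/2" "f (a, y) \<le> f (x, y) + e/2"
      if "y \<in> topspace Y" for y
    proof -
      have "(x, y) \<in> W"
        using U \<open>x \<in> U\<close> that by blast
      then show "f (x, y) \<le> f (a, y) + e/2" "f (a, y) \<le> f (x, y) + e/2"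
        by (auto simp: W_def)
    qed
    have "(SUP y\<in>topspace Y. f (x, y)) \<le> (SUP y\<in>topspace Y. f (a, y)) + e/2"
    proof (rule cSUP_least[OF ne])
      fix y assume y: "y \<in> topspace Y"
      show "f (x, y) \<le> (SUP y\<in>topspace Y. f (a, y)) + e/2"
        using near(1)[OF y] cSUP_upper[OF y bdd[OF a]] by linarith
    qed
    moreover have "(SUP y\<in>topspace Y. f (a, y)) \<le> (SUP y\<in>topspace Y. f (x, y)) + e/2"
    proof (rule cSUP_least[OF ne])
      fix y assume y: "y \<in> topspace Y"
      show "f (a, y) \<le> (SUP y\<in>topspace Y. f (x, y)) + e/2"
        using near(2)[OF y] cSUP_upper[OF y bdd[OF x]] by linarith
    qed
    ultimately show ?thesis
      using e by linarith
  qed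
  with U show "\<exists>U. openin X U \<and> a \<in> U \<and>
      (\<forall>x\<in>U. \<bar>(SUP y\<in>topspace Y. f (x, y)) - (SUP y\<in>topspace Y. f (a, y))\<bar> < e)"
    by blast
qed

lemma k_continuous_Times:
  assumes "k_continuous (prod_topology X Y) f" "compactin X K" "compactin Y L"
  shows "continuous_map (prod_topology (subtopology X K) (subtopology Y L)) euclideanreal f"
  using assms by (simp add: k_continuous_def compactin_Times flip: subtopology_Times)

text \<open>Points are compact, so \<open>{a} \<times> L\<close> is a compact set on which
  \<open>f\<close> is continuous; compose with the embedding of \<open>L\<close> at height
  \<open>a\<close>.\<close>

lemma k_continuous_slice:
  assumes f: "k_continuous (prod_topology X Y) f" and L: "compactin Y L" and a: "a \<in> topspace X"
  shows "continuous_map (subtopology Y L) euclideanreal (\<lambda>y. f (a, y))"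
proof -
  have "continuous_map (prod_topology (subtopology X {a}) (subtopology Y L)) euclideanreal f"
    using k_continuous_Times[OF f _ L] a by simp
  moreover have "continuous_map (subtopology Y L)
      (prod_topology (subtopology X {a}) (subtopology Y L)) (\<lambda>y. (a, y))"
    using a by (intro continuous_map_pairedI) auto
  ultimately show ?thesis
    using continuous_map_compose[of _ _ "\<lambda>y. (a, y)" _ f] by (simp add: o_def)
qed

text \<open>This moves \<open>k\<close>-continuity from the product to \<open>X\<close> alone. For
  compact \<open>K\<close>, \<open>f\<close> is jointly continuous on the compact set
  \<open>K \<times> L\<close>, so the supremum over the compact factor \<open>L\<close> is
  continuous on \<open>K\<close>.\<close>

lemma k_continuous_SUP_deviation:
  assumes f: "k_continuous (prod_topology X Y) f" and L: "compactin Y L" "L \<noteq> {}"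
    and a: "a \<in> topspace X"
  shows "k_continuous X (\<lambda>x. SUP y\<in>L. \<bar>f (x, y) - f (a, y)\<bar>)"
  unfolding k_continuous_def
proof (intro allI impI)
  fix K assume K: "compactin X K"
  let ?P = "prod_topology (subtopology X K) (subtopology Y L)"
  have top: "topspace (subtopology Y L) = L"
    using L compactin_subset_topspace by fastforce
  have "continuous_map ?P euclideanreal (\<lambda>p. f (a, snd p))"
    using continuous_map_compose[OF continuous_map_snd k_continuous_slice[OF f L(1) a]]
    by (simp add: o_def)
  then have "continuous_map ?P euclideanreal (\<lambda>p. \<bar>f p - f (a, snd p)\<bar>)"
    using k_continuous_Times[OF f K L(1)]
    by (intro continuous_map_real_abs continuous_map_diff)
  from continuous_map_SUP_compact_space[OF _ _ this]
  show "continuous_map (subtopology X K) euclideanreal (\<lambda>x. SUP y\<in>L. \<bar>f (x, y) - f (a, y)\<bar>)"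
    unfolding top using L by (simp add: compact_space_subtopology)
qed

theorem theorem4p2:
  fixes X :: "'a topology" and Y :: "'b topology"
  assumes "Tychonoff_space Y" and "locally_compact_space Y"
    and "Tychonoff_space X" and "kR_space X"
  shows "kR_space (prod_topology X Y)"
  unfolding kR_space_def
proof (intro allI impI)
  fix f :: "'a \<times> 'b \<Rightarrow> real"
  assume f: "k_continuous (prod_topology X Y) f"
  show "continuous_map (prod_topology X Y) euclideanreal f"
    unfolding continuous_map_euclideanreal_iff
  proof (intro ballI allI impI)
    fix p and e :: real
    assume p: "p \<in> topspace (prod_topology X Y)" and e: "e > 0"
    obtain a b where ab: "p = (a, b)" "a \<in> topspace X" "b \<in> topspace Y"
      using p by auto
    obtain V L where V: "openin Y V" "compactin Y L" "b \<in> V" "V \<subseteq> L"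
      using assms(2) ab unfolding locally_compact_space_def by blast
    define g where "g x = (SUP y\<in>L. \<bar>f (x, y) - f (a, y)\<bar>)" for x
    have ne: "L \<noteq> {}"
      using V by blast
    \<comment> \<open>Here the \<open>kR_space\<close> hypothesis turns continuity on compact sets
      into continuity on \<open>X\<close>.\<close>
    have "continuous_map X euclideanreal g"
      using k_continuous_SUP_deviation[OF f V(2) ne ab(2)] assms(4)
      unfolding kR_space_def g_def by blast
    moreover have ga: "g a = 0"
      using ne by (simp add: g_def)
    \<comment> \<open>Half of \<open>e\<close> is spent on moving \<open>x\<close> away from
      \<open>a\<close>; the other half is kept for moving \<open>y\<close> away from
      \<open>b\<close>.\<close>
    ultimately have "\<exists>U. openin X U \<and> a \<in> U \<and> (\<forall>x\<in>U. \<bar>g x - g a\<bar> < e/2)"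
      using ab(2) half_gt_zero[OF e] unfolding continuous_map_euclideanreal_iff by blast
    then obtain U where U: "openin X U" "a \<in> U" "\<And>x. x \<in> U \<Longrightarrow> \<bar>g x\<bar> < e/2"
      unfolding ga by auto
    have slice: "continuous_map (subtopology Y L) euclideanreal (\<lambda>y. f (x, y))"
      if "x \<in> topspace X" for x
      by (rule k_continuous_slice[OF f V(2) that])
    have "b \<in> topspace (subtopology Y L)"
      using V ab by auto
    then have "\<exists>T. openin (subtopology Y L) T \<and> b \<in> T \<and>
        (\<forall>y\<in>T. \<bar>f (a, y) - f (a, b)\<bar> < e/2)"
      using slice[OF ab(2), unfolded continuous_map_euclideanreal_iff] half_gt_zero[OF e]
      by presburger
    then obtain T where T: "openin (subtopology Y L) T" "b \<in> T"
        "\<And>y. y \<in> T \<Longrightarrow> \<bar>f (a, y) - f (a, b)\<bar> < e/2"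
      by auto
    \<comment> \<open>\<open>T\<close> is open only relative to \<open>L\<close>. Since
      \<open>V \<subseteq> L\<close>, the set \<open>S \<inter> V\<close> is open in
      \<open>Y\<close>, lies inside \<open>T\<close> and still contains \<open>b\<close>.\<close>
    obtain S where S: "openin Y S" "T = S \<inter> L"
      using T(1) by (auto simp: openin_subtopology)
    \<comment> \<open>Triangle inequality through \<open>f (a, y)\<close>: the first part is at most
      \<open>g x\<close>, the second is controlled by \<open>T\<close>.\<close>
    have close: "\<bar>f (x, y) - f (a, b)\<bar> < e" if "x \<in> U" "y \<in> S \<inter> V" for x y
    proof -
      have x: "x \<in> topspace X"
        using U(1) that(1) openin_subset by blast
      have "compactin euclideanreal ((\<lambda>y. \<bar>f (x, y) - f (a, y)\<bar>) ` L)"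
        by (rule image_compactin[where X = "subtopology Y L"])
          (auto intro!: continuous_map_real_abs continuous_map_diff slice x ab(2)
             simp: compactin_subtopology V(2))
      then have "bdd_above ((\<lambda>y. \<bar>f (x, y) - f (a, y)\<bar>) ` L)"
        by (simp add: bounded_imp_bdd_above compact_imp_bounded)
      then have "\<bar>f (x, y) - f (a, y)\<bar> \<le> g x"
        unfolding g_def using that V by (intro cSUP_upper) auto
      moreover have "\<bar>f (a, y) - f (a, b)\<bar> < e/2"
        using T(3) S(2) that V(4) by blast
      ultimately show ?thesis
        using U(3)[OF that(1)] by linarith
    qed
    show "\<exists>W. openin (prod_topology X Y) W \<and> p \<in> W \<and> (\<forall>q\<in>W. \<bar>f q - f p\<bar> < e)"
    proof (intro exI conjI)
      show "openin (prod_topology X Y) (U \<times> (S \<inter> V))"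
        using U(1) S(1) V(1) by (simp add: openin_prod_Times_iff openin_Int)
      show "p \<in> U \<times> (S \<inter> V)"
        using U(2) T(2) S(2) V(3) ab(1) by blast
      show "\<forall>q\<in>U \<times> (S \<inter> V). \<bar>f q - f p\<bar> < e"
        using close ab(1) by auto
    qed
  qed
qed

end
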